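(* For all integers $n\ge 3$ and all integers $k$ such that $2\le k\le n-1$, we have $$E(n,k)^2\ge E(n,k-1)\,E(n,k+1).$$ If, in addition, $n\ge k^2-2k+2$, then the strict inequality $$E(n,k)^2> E(n,k-1)\,E(n,k+1)$$ holds.
   Context: For integers $1\le k\le n$, $E(n,k):=\max a_1\cdots a_k$, where the maximum is over tuples of integers $a_1,\ldots,a_k\ge 1$ such that $a_1+\cdots+a_k=n$. *)

theory Defs
  imports Complex_Main
begin

definition compositions :: "nat \<Rightarrow> nat \<Rightarrow> nat list set" where
  "compositions n k = {as. length as = k \<and> (\<forall>a\<in>set as. a \<ge> 1) \<and> sum_list as = n}"

definition E :: "nat \<Rightarrow> nat \<Rightarrow> nat" where
  "E n k = Max (prod_list ` compositions n k)"

lemma finite_compositions: "finite (compositions n k)"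
proof (rule finite_subset)
  show "compositions n k \<subseteq> {as. set as \<subseteq> {..n} \<and> length as = k}"
    unfolding compositions_def using member_le_sum_list by fastforce
  show "finite {as. set as \<subseteq> {..n} \<and> length as = k}"
    by (rule finite_lists_length_eq) simp
qed

lemma compositions_nonempty:
  assumes "1 \<le> k" "k \<le> n"
  shows "compositions n k \<noteq> {}"
proof -
  have "(n - k + 1) # replicate (k - 1) 1 \<in> compositions n k"
    using assms by (auto simp: compositions_def sum_list_replicate)
  then show ?thesis by blast
qed

end

theory Submission
  imports Defs
begin

text \<open>
  Let \<open>q = n div k\<close>. The logarithm is strictly concave, so on the positive integers it
  lies below the line through its values at \<open>q\<close> and \<open>q + 1\<close>, and meets it only at these two points.
  Exponentiated, this bounds every positive integer \<open>x\<close> by \<open>q * (1 + 1/q)^(x - q)\<close>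
  (\<open>le_expchord\<close>, \<open>less_expchord\<close>). A product of such bounds depends only on the number of factors
  and on their sum (\<open>prod_list_expchord\<close>). Hence an optimal tuple of length \<open>k - 1\<close> and one
  of length \<open>k + 1\<close>, which together have \<open>2k\<close> entries with sum \<open>2n\<close>, are bounded jointly by the
  square of the value for \<open>k\<close> entries with sum \<open>n\<close>; and this value is attained, by the balanced
  tuple with entries \<open>q\<close> and \<open>q + 1\<close> (\<open>E_ge_expchord\<close>). This is the inequality.

  Equality would force all entries of both tuples into \<open>{q, q + 1}\<close>, so that
  \<open>(k + 1) * q \<le> n \<le> (k - 1) * (q + 1)\<close>. Then \<open>2 * q \<le> k - 1\<close>, and therefore
  \<open>2 * n \<le> k^2 - 1\<close>, which is incompatible with \<open>n \<ge> k^2 - 2 * k + 2\<close> because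
  \<open>2 * (k^2 - 2 * k + 2) - (k^2 - 1) = (k - 2)^2 + 1\<close> is positive.
\<close>

text \<open>
  The exponential function of \<open>x\<close> that takes the value \<open>x\<close> at \<open>q\<close> and at \<open>q + 1\<close>.
\<close>
definition expchord :: "nat \<Rightarrow> nat \<Rightarrow> real" where
  "expchord q x = real q * (1 + 1 / real q) powi (int x - int q)"

lemma expchord_pos: "q > 0 \<Longrightarrow> expchord q x > 0"
  by (auto simp: expchord_def add_pos_nonneg)

lemma expchord_at_left [simp]: "expchord q q = real q"
  by (simp add: expchord_def)

lemma expchord_at_right [simp]: "q > 0 \<Longrightarrow> expchord q (Suc q) = real (Suc q)"
  by (simp add: expchord_def field_simps)

text \<open>
  To the right of \<open>q + 1\<close> this is Bernoulli's inequality for \<open>1 + 1/q\<close>, with one factor split off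
  to gain strictness. To the left of \<open>q\<close> it is Bernoulli's inequality for the reciprocal
  \<open>1 - 1/(q + 1)\<close>, whose slope is smaller than the required \<open>1/q\<close>.
\<close>
lemma less_expchord:
  assumes "q > 0" "x \<notin> {q, Suc q}"
  shows "real x < expchord q x"
proof (cases "x > q")
  case True
  define d where "d = x - q - 1"
  have d: "x = q + 1 + d" "d > 0"
    using True assms(2) by (auto simp: d_def)
  define t where "t = 1 / real q"
  have t: "t > 0" "real q * t = 1"
    using assms(1) by (auto simp: t_def)
  have "1 + (1 + real d) * t < (1 + t) * (1 + real d * t)"
    using t d by (simp add: algebra_simps)
  also have "\<dots> \<le> (1 + t) * (1 + t) ^ d"
    using t by (intro mult_left_mono Bernoulli_inequality) auto
  finally have "real q * (1 + (1 + real d) * t) < real q * (1 + t) ^ Suc d"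
    using assms(1) by simp
  moreover have "real q * (1 + (1 + real d) * t) = real q + (1 + real d) * (real q * t)"
    by (simp add: algebra_simps)
  moreover have "int x - int q = int (Suc d)"
    using d by simp
  then have "expchord q x = real q * (1 + t) ^ Suc d"
    unfolding expchord_def t_def by (simp only: power_int_of_nat)
  ultimately show ?thesis
    using t d by simp
next
  case False
  define e where "e = q - x"
  have e: "q = x + e" "e > 0"
    using False assms(2) by (auto simp: e_def)
  have "real x = real q * (1 - real e / real q)"
    using assms(1) e by (simp add: field_simps)
  also have "\<dots> < real q * (1 + real e * (- 1 / (real q + 1)))"
    using assms(1) e(2) by (simp add: frac_less2)
  also have "\<dots> \<le> real q * (1 + (- 1 / (real q + 1))) ^ e"
    by (intro mult_left_mono Bernoulli_inequality) (auto simp: field_simps)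
  also have "1 + (- 1 / (real q + 1)) = inverse (1 + 1 / real q)"
    using assms(1) by (simp add: field_simps)
  also have "real q * inverse (1 + 1 / real q) ^ e = expchord q x"
  proof -
    have "int x - int q = - int e"
      using e by simp
    then show ?thesis
      by (simp add: expchord_def power_int_minus power_inverse)
  qed
  finally show ?thesis .
qed

lemma le_expchord: "q > 0 \<Longrightarrow> real x \<le> expchord q x"
  using less_expchord[of q x] by (cases "x \<in> {q, Suc q}") auto

lemma prod_list_expchord:
  assumes "q > 0"
  shows "prod_list (map (expchord q) xs) =
    real q ^ length xs * (1 + 1 / real q) powi (int (sum_list xs) - int q * int (length xs))"
proof (induction xs)
  case (Cons x xs)
  define \<rho> where "\<rho> = 1 + 1 / real q"
  have "\<rho> \<noteq> 0"
    using assms by (simp add: \<rho>_def add_eq_0_iff field_simps)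
  have "prod_list (map (expchord q) (x # xs)) = real q ^ length (x # xs) *
      (\<rho> powi (int x - int q) * \<rho> powi (int (sum_list xs) - int q * int (length xs)))"
    using Cons by (simp add: expchord_def[of q x] \<rho>_def)
  also have "\<rho> powi (int x - int q) * \<rho> powi (int (sum_list xs) - int q * int (length xs)) =
      \<rho> powi ((int x - int q) + (int (sum_list xs) - int q * int (length xs)))"
    using \<open>\<rho> \<noteq> 0\<close> by (intro power_int_add[symmetric] disjI1)
  also have "(int x - int q) + (int (sum_list xs) - int q * int (length xs)) =
      int (sum_list (x # xs)) - int q * int (length (x # xs))"
    by (simp add: algebra_simps)
  finally show ?case
    by (simp only: \<rho>_def)
qed simp

lemma prod_list_pos:
  fixes xs :: "'a :: linordered_semidom list"
  shows "(\<And>x. x \<in> set xs \<Longrightarrow> x > 0) \<Longrightarrow> prod_list xs > 0"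
  by (induction xs) auto

lemma prod_list_le_expchord:
  assumes "q > 0"
  shows "real (prod_list xs) \<le> prod_list (map (expchord q) xs)"
  by (induction xs)
     (auto intro!: mult_mono le_expchord less_imp_le[OF expchord_pos] assms)

text \<open>
  One badly placed entry makes the bound strict, since all other factors of the bound are positive.
\<close>
lemma prod_list_less_expchord:
  assumes "q > 0" "y \<in> set xs" "y \<notin> {q, Suc q}"
  shows "real (prod_list xs) < prod_list (map (expchord q) xs)"
  using assms(2)
proof (induction xs)
  case (Cons x xs)
  have pos: "prod_list (map (expchord q) xs) > 0"
    using assms(1) by (intro prod_list_pos) (auto simp: expchord_pos)
  show ?case
  proof (cases "y = x")
    case True
    have "real x * real (prod_list xs) \<le> real x * prod_list (map (expchord q) xs)"
      using assms(1) by (intro mult_left_mono prod_list_le_expchord) auto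
    also have "\<dots> < expchord q x * prod_list (map (expchord q) xs)"
      using pos less_expchord[OF assms(1,3)] True by (intro mult_strict_right_mono) auto
    finally show ?thesis by simp
  next
    case False
    then have "real (prod_list xs) < prod_list (map (expchord q) xs)"
      using Cons by auto
    then have "expchord q x * real (prod_list xs) < expchord q x * prod_list (map (expchord q) xs)"
      using expchord_pos[OF assms(1)] by (intro mult_strict_left_mono) auto
    moreover have "real x * real (prod_list xs) \<le> expchord q x * real (prod_list xs)"
      using assms(1) by (intro mult_right_mono le_expchord) auto
    ultimately show ?thesis by simp
  qed
qed simp

lemma E_ge: "as \<in> compositions n k \<Longrightarrow> prod_list as \<le> E n k"
  unfolding E_def by (intro Max_ge finite_imageI finite_compositions imageI)

lemma E_attained:
  assumes "1 \<le> k" "k \<le> n"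
  obtains as where "as \<in> compositions n k" "E n k = prod_list as"
proof -
  have "E n k \<in> prod_list ` compositions n k"
    unfolding E_def using assms by (intro Max_in) (auto simp: finite_compositions compositions_nonempty)
  then show ?thesis using that by auto
qed

text \<open>
  The balanced tuple, with \<open>n mod k\<close> entries \<open>q + 1\<close> and all others \<open>q\<close>, consists of the two points
  at which the exponential bound is sharp.
\<close>
lemma E_ge_expchord:
  assumes "1 \<le> k" "k \<le> n" and q: "q = n div k"
  shows "real q ^ k * (1 + 1 / real q) powi (int n - int q * int k) \<le> real (E n k)"
proof -
  define r where "r = n mod k"
  define xs where "xs = replicate r (Suc q) @ replicate (k - r) q"
  have q0: "q > 0"
    using assms by (simp add: div_greater_zero_iff)
  have r: "r < k" "n = q * k + r"
    using assms by (auto simp: r_def)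
  have len: "length xs = k"
    using r by (simp add: xs_def)
  have "sum_list xs = r * Suc q + (k - r) * q"
    by (simp add: xs_def sum_list_replicate)
  also have "\<dots> = (r + (k - r)) * q + r"
    by (simp add: algebra_simps)
  also have "\<dots> = n"
    using r by simp
  finally have sum: "sum_list xs = n" .
  have "xs \<in> compositions n k"
    using q0 len sum by (auto simp: compositions_def) (auto simp: xs_def)
  then have "prod_list xs \<le> E n k"
    by (rule E_ge)
  moreover have "real (prod_list xs) = prod_list (map (expchord q) xs)"
    using q0 by (simp add: xs_def)
  ultimately show ?thesis
    using prod_list_expchord[OF q0, of xs] len sum by simp
qed

lemma sum_list_le_length_times:
  fixes xs :: "nat list"
  shows "(\<And>x. x \<in> set xs \<Longrightarrow> x \<le> c) \<Longrightarrow> sum_list xs \<le> length xs * c"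
  using sum_list_mono[of xs id "\<lambda>_. c"] by (simp add: sum_list_triv)

lemma length_times_le_sum_list:
  fixes xs :: "nat list"
  shows "(\<And>x. x \<in> set xs \<Longrightarrow> c \<le> x) \<Longrightarrow> length xs * c \<le> sum_list xs"
  using sum_list_mono[of xs "\<lambda>_. c" id] by (simp add: sum_list_triv)

theorem theorem1p3:
  fixes n k :: nat
  assumes "n \<ge> 3" and "2 \<le> k" and "k \<le> n - 1"
  shows "(E n k)\<^sup>2 \<ge> E n (k - 1) * E n (k + 1)
    \<and> (int n \<ge> (int k)\<^sup>2 - 2 * int k + 2 \<longrightarrow> (E n k)\<^sup>2 > E n (k - 1) * E n (k + 1))"
proof -
  define q where "q = n div k"
  have q0: "q > 0"
    using assms by (simp add: q_def div_greater_zero_iff)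
  obtain as where as: "as \<in> compositions n (k - 1)" "E n (k - 1) = prod_list as"
  proof (rule E_attained)
    show "1 \<le> k - 1" "k - 1 \<le> n"
      using assms by auto
  qed
  obtain bs where bs: "bs \<in> compositions n (k + 1)" "E n (k + 1) = prod_list bs"
  proof (rule E_attained)
    show "1 \<le> k + 1" "k + 1 \<le> n"
      using assms by auto
  qed
  have as_len: "length as = k - 1" and as_sum: "sum_list as = n"
    and bs_len: "length bs = k + 1" and bs_sum: "sum_list bs = n"
    using as(1) bs(1) by (auto simp: compositions_def)
  define B where "B = real q ^ k * (1 + 1 / real q) powi (int n - int q * int k)"
  have "B \<le> real (E n k)"
    unfolding B_def using assms by (intro E_ge_expchord) (auto simp: q_def)
  moreover have "B \<ge> 0"
    by (simp add: B_def)
  ultimately have B_le: "B\<^sup>2 \<le> real ((E n k)\<^sup>2)"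
    by (simp add: power_mono)
  have base: "1 + 1 / real q \<noteq> 0"
    using q0 by (simp add: add_eq_0_iff field_simps)
  have "prod_list (map (expchord q) (as @ bs)) =
      real q ^ (k + k) * (1 + 1 / real q) powi
        ((int n - int q * int k) + (int n - int q * int k))"
  proof -
    have "length (as @ bs) = k + k" "sum_list (as @ bs) = n + n"
      using as_len bs_len as_sum bs_sum assms by auto
    then show ?thesis
      unfolding prod_list_expchord[OF q0] by (simp add: algebra_simps)
  qed
  also have "\<dots> = B\<^sup>2"
    unfolding B_def power_int_add[OF disjI1[OF base]] power_add power2_eq_square
    by (simp only: mult_ac)
  finally have chord: "prod_list (map (expchord q) (as @ bs)) = B\<^sup>2" .
  have prod: "real (E n (k - 1) * E n (k + 1)) = real (prod_list (as @ bs))"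
    using as(2) bs(2) by simp
  have "real (E n (k - 1) * E n (k + 1)) \<le> real ((E n k)\<^sup>2)"
    using prod_list_le_expchord[OF q0, of "as @ bs"] chord B_le prod by linarith
  then have weak: "(E n k)\<^sup>2 \<ge> E n (k - 1) * E n (k + 1)"
    by (simp only: of_nat_le_iff)
  have strict: "(E n k)\<^sup>2 > E n (k - 1) * E n (k + 1)"
    if large: "int n \<ge> (int k)\<^sup>2 - 2 * int k + 2"
  proof -
    have "\<exists>y\<in>set (as @ bs). y \<notin> {q, Suc q}"
    proof (rule ccontr)
      assume "\<not> ?thesis"
      then have mem: "\<And>y. y \<in> set as \<union> set bs \<Longrightarrow> y = q \<or> y = Suc q"
        by auto
      have "sum_list as \<le> length as * Suc q"
        by (intro sum_list_le_length_times) (use mem in force)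
      then have "int n \<le> int ((k - 1) * Suc q)"
        by (simp only: as_len as_sum of_nat_le_iff)
      moreover have "int (k - 1) = int k - 1"
        using assms by simp
      ultimately have up: "int n \<le> (int k - 1) * (int q + 1)"
        unfolding of_nat_mult by (simp add: add.commute)
      have "length bs * q \<le> sum_list bs"
        by (intro length_times_le_sum_list) (use mem in force)
      then have "int ((k + 1) * q) \<le> int n"
        by (simp only: bs_len bs_sum of_nat_le_iff)
      then have low: "(int k + 1) * int q \<le> int n"
        by (simp add: algebra_simps)
      have "2 * int q \<le> int k - 1"
        using up low by (simp add: algebra_simps)
      then have "(int k - 1) * (2 * int q + 2) \<le> (int k - 1) * (int k + 1)"
        using assms by (intro mult_left_mono) auto
      then have "2 * int n \<le> (int k)\<^sup>2 - 1"
        using up by (simp add: algebra_simps power2_eq_square)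
      moreover have "(int k)\<^sup>2 - 4 * int k + 4 \<ge> 0"
        using zero_le_power2[of "int k - 2"] by (simp add: power2_eq_square algebra_simps)
      ultimately show False
        using large by linarith
    qed
    then have "real (E n (k - 1) * E n (k + 1)) < real ((E n k)\<^sup>2)"
      using prod_list_less_expchord[OF q0, of _ "as @ bs"] chord B_le prod by fastforce
    then show ?thesis
      by (simp only: of_nat_less_iff)
  qed
  show ?thesis
    using weak strict by blast
qed

end
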